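(* Let $r>0$, $\sigma>0$, and let $\mu_{\mathrm{MP}}$ be the Marchenko-Pastur distribution with parameters $r,\sigma^2$. Set $\rho=\frac{1+r}{\sqrt r}$, $\delta_0=0$, and $\delta_t=(-\rho-\delta_{t-1})^{-1}$ for $t\ge1$. Then the sequence of polynomials $P_0,P_1,\dots$ defined by $P_{-1}(\lambda)=0$, $P_0(\lambda)=1$ and $$P_t(\lambda)=\left(-\rho\,\delta_t+\frac{\delta_t}{\sigma^2\sqrt r}\lambda\right)P_{t-1}(\lambda)+(1+\rho\,\delta_t)P_{t-2}(\lambda)\qquad(t\ge1)$$ is orthogonal with respect to the weight function $\lambda\,\mathrm{d}\mu_{\mathrm{MP}}(\lambda)$.
   Context: The Marchenko-Pastur distribution with parameters $r,\sigma^2$ is $$\mathrm{d}\mu_{\mathrm{MP}}(\lambda)=\max\{1-\tfrac1r,0\}\,\delta_0(\lambda)+\frac{\sqrt{(L-\lambda)(\lambda-\ell)}}{2\pi\sigma^2r\lambda}1_{\lambda\in[\ell,L]}\,\mathrm{d}\lambda,$$ where $\ell=\sigma^2(1-\sqrt r)^2$, $L=\sigma^2(1+\sqrt r)^2$, and in this formula $\delta_0(\lambda)$ denotes the Dirac mass at $0$ (not the scalar $\delta_0$ of the recurrence). A sequence $P_0,P_1,\dots$ is orthogonal with respect to a measure $\mathrm{d}\alpha$ (for which all polynomials are integrable) if $P_i$ has degree $i$, $\int P_iP_j\,\mathrm{d}\alpha=0$ for $i\ne j$, and $\int P_i^2\,\mathrm{d}\alpha>0$. *)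

theory Defs
  imports
    "HOL-Probability.Probability"
    "HOL-Computational_Algebra.Polynomial"
begin

definition mp_density :: "real \<Rightarrow> real \<Rightarrow> real \<Rightarrow> real" where
  "mp_density r v x =
     (let l = v * (1 - sqrt r)^2; L = v * (1 + sqrt r)^2
      in sqrt ((L - x) * (x - l)) / (2 * pi * v * r * x) * indicator {l..L} x)"

text \<open>The parameter \<open>v\<close> is the variance \<open>\<sigma>\<^sup>2\<close>, not \<open>\<sigma>\<close>. The libraries have no sum of two
  measures on the same space, so the sum of the atom and the absolutely continuous part is
  taken setwise; \<open>emeasure_marchenko_pastur\<close> shows that this does define a measure.\<close>

definition marchenko_pastur :: "real \<Rightarrow> real \<Rightarrow> real measure" where
  "marchenko_pastur r v =
     measure_of UNIV (sets borel)
       (\<lambda>A. ennreal (max (1 - 1 / r) 0) * emeasure (return borel 0) A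
            + emeasure (density lborel (\<lambda>x. ennreal (mp_density r v x))) A)"

lemma sets_marchenko_pastur [simp, measurable_cong]: "sets (marchenko_pastur r v) = sets borel"
  unfolding marchenko_pastur_def using sets.sigma_sets_eq[of "borel :: real measure"] by simp

lemma space_marchenko_pastur [simp]: "space (marchenko_pastur r v) = UNIV"
  unfolding marchenko_pastur_def by (simp add: space_measure_of_conv)

lemma emeasure_marchenko_pastur:
  assumes "A \<in> sets borel"
  shows "emeasure (marchenko_pastur r v) A =
           ennreal (max (1 - 1 / r) 0) * emeasure (return borel 0) A
           + emeasure (density lborel (\<lambda>x. ennreal (mp_density r v x))) A"
  unfolding marchenko_pastur_def
proof (rule emeasure_measure_of_sigma)
  show "sigma_algebra UNIV (sets (borel :: real measure))"
    using sets.sigma_algebra_axioms[of "borel :: real measure"] by simp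
  show "positive (sets borel)
     (\<lambda>A. ennreal (max (1 - 1 / r) 0) * emeasure (return borel 0) A
          + emeasure (density lborel (\<lambda>x. ennreal (mp_density r v x))) A)"
    by (simp add: positive_def)
  show "countably_additive (sets borel)
     (\<lambda>A. ennreal (max (1 - 1 / r) 0) * emeasure (return borel 0) A
          + emeasure (density lborel (\<lambda>x. ennreal (mp_density r v x))) A)"
  proof (rule countably_additiveI)
    fix F :: "nat \<Rightarrow> real set"
    assume F: "range F \<subseteq> sets borel" "disjoint_family F"
    let ?M = "return borel (0::real)"
      and ?N = "density lborel (\<lambda>x. ennreal (mp_density r v x))"
    have "(\<Sum>i. emeasure ?M (F i)) = emeasure ?M (\<Union>i. F i)"
         "(\<Sum>i. emeasure ?N (F i)) = emeasure ?N (\<Union>i. F i)"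
      by (rule suminf_emeasure, use F in simp_all)+
    then show "(\<Sum>i. ennreal (max (1 - 1 / r) 0) * emeasure ?M (F i) + emeasure ?N (F i))
        = ennreal (max (1 - 1 / r) 0) * emeasure ?M (\<Union>i. F i) + emeasure ?N (\<Union>i. F i)"
      by (simp add: suminf_add[symmetric])
  qed
qed (rule assms)

definition orthogonal_polynomials :: "real measure \<Rightarrow> (nat \<Rightarrow> real poly) \<Rightarrow> bool" where
  "orthogonal_polynomials \<alpha> P \<longleftrightarrow>
     (\<forall>p :: real poly. integrable \<alpha> (\<lambda>x. poly p x)) \<and>
     (\<forall>i. degree (P i) = i) \<and>
     (\<forall>i j. i \<noteq> j \<longrightarrow> (LINT x|\<alpha>. poly (P i) x * poly (P j) x) = 0) \<and>
     (\<forall>i. (LINT x|\<alpha>. (poly (P i) x)^2) > 0)"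

end

theory Submission
  imports Defs
begin

text \<open>
  The factor \<open>\<lambda>\<close> removes the atom at \<open>0\<close> and cancels the denominator of the density, so
  \<open>\<lambda> d\<mu>\<close> is a semicircle law with centre \<open>c = \<sigma>\<^sup>2(1 + r)\<close> and radius \<open>R = 2\<sigma>\<^sup>2\<surd>r\<close>.
  Since \<open>1 + \<rho> \<delta>\<^sub>t = - \<delta>\<^sub>t \<delta>\<^sub>t\<^sub>-\<^sub>1\<close> and \<open>\<lambda> / (\<sigma>\<^sup>2\<surd>r) - \<rho> = 2 (\<lambda> - c) / R\<close>, the recurrence is a
  rescaling of that of the Chebyshev polynomials of the second kind: with \<open>\<lambda> = c - R cos \<theta>\<close>
  one gets \<open>P\<^sub>t(\<lambda>) sin \<theta> = a\<^sub>t sin ((t + 1) \<theta>)\<close> where \<open>a\<^sub>t = (- \<delta>\<^sub>1) \<cdots> (- \<delta>\<^sub>t) > 0\<close>. The substitution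
  thus reduces orthogonality to that of the functions \<open>sin (n \<theta>)\<close> on \<open>[0, \<pi>]\<close>.
\<close>

section \<open>Trigonometric integrals and the semicircle substitution\<close>

lemma LINT_cos_int_multiple:
  fixes k :: int
  shows "integrable lborel (\<lambda>x. cos (of_int k * x) * indicator {0..pi} x)"
    and "(LBINT x. cos (of_int k * x) * indicator {0..pi} x) = (if k = 0 then pi else 0)"
proof -
  define F where "F = (\<lambda>x::real. if k = 0 then x else sin (of_int k * x) / of_int k)"
  have deriv: "DERIV F x :> cos (of_int k * x)" for x
    unfolding F_def by (cases "k = 0") (auto intro!: derivative_eq_intros)
  have "has_bochner_integral lborel (\<lambda>x. cos (of_int k * x) * indicator {0..pi} x) (F pi - F 0)"
    by (rule has_bochner_integral_FTC_Icc_real[OF _ deriv]) (auto intro!: continuous_intros)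
  moreover have "F pi - F 0 = (if k = 0 then pi else 0)"
    by (simp add: F_def mult.commute sin_int_times_real)
  ultimately show "integrable lborel (\<lambda>x. cos (of_int k * x) * indicator {0..pi} x)"
    and "(LBINT x. cos (of_int k * x) * indicator {0..pi} x) = (if k = 0 then pi else 0)"
    by (simp_all add: has_bochner_integral_iff)
qed

text \<open>The product is half the difference of cosines of frequencies \<open>m - n\<close> and
  \<open>m + n\<close>; \<open>m > 0\<close> makes \<open>m + n\<close> nonzero, so only the first
  cosine can contribute, and only when \<open>m = n\<close>.\<close>

lemma LINT_sin_times_sin:
  fixes m n :: nat
  assumes "m > 0"
  shows "(LBINT x. sin (real m * x) * sin (real n * x) * indicator {0..pi} x)
    = (if m = n then pi / 2 else 0)"
proof -
  have "sin (real m * x) * sin (real n * x) * indicator {0..pi} x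
      = (cos (of_int (int m - int n) * x) * indicator {0..pi} x
         - cos (of_int (int m + int n) * x) * indicator {0..pi} x) / 2" for x
    by (simp add: sin_times_sin algebra_simps diff_divide_distrib)
  then show ?thesis
    using assms by (simp only: integral_divide_zero Bochner_Integration.integral_diff LINT_cos_int_multiple) auto
qed

text \<open>The minus sign in \<open>c - R * cos x\<close> makes the substitution increasing from
  \<open>c - R\<close> to \<open>c + R\<close> on \<open>{0..pi}\<close>. There \<open>sin x\<close>
  is nonnegative, so the square root becomes \<open>R * sin x\<close>, which is also the
  Jacobian.\<close>

lemma LINT_semicircle_substitution:
  fixes c R :: real
  assumes "R > 0" and f: "continuous_on UNIV f"
  shows "integrable lborel (\<lambda>x. f x * sqrt (R\<^sup>2 - (x - c)\<^sup>2) * indicator {c - R..c + R} x)"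
    and "(LBINT x. f x * sqrt (R\<^sup>2 - (x - c)\<^sup>2) * indicator {c - R..c + R} x)
      = (LBINT x. f (c - R * cos x) * (R * sin x)\<^sup>2 * indicator {0..pi} x)"
proof -
  let ?h = "\<lambda>x. f x * sqrt (R\<^sup>2 - (x - c)\<^sup>2)"
  have "set_integrable lborel {c - R..c + R} ?h"
    by (intro borel_integrable_atLeastAtMost' continuous_intros continuous_on_subset[OF f]) simp
  then show "integrable lborel (\<lambda>x. ?h x * indicator {c - R..c + R} x)"
    by (simp add: set_integrable_def mult.commute)
  have pointwise: "?h (c - R * cos x) * (R * sin x) * indicator {0..pi} x
      = f (c - R * cos x) * (R * sin x)\<^sup>2 * indicator {0..pi} x" for x
  proof (cases "x \<in> {0..pi}")
    case True
    have "R\<^sup>2 - (c - R * cos x - c)\<^sup>2 = (R * sin x)\<^sup>2"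
      by (simp add: power_mult_distrib sin_squared_eq algebra_simps)
    moreover have "R * sin x \<ge> 0"
      using True assms(1) by (simp add: sin_ge_zero)
    ultimately show ?thesis
      by (simp add: power2_eq_square)
  qed simp
  have "(LBINT x. ?h x * indicator {c - R * cos 0..c - R * cos pi} x)
      = (LBINT x. ?h (c - R * cos x) * (R * sin x) * indicator {0..pi} x)"
  proof (rule integral_substitution)
    show "set_integrable lborel {c - R * cos 0..c - R * cos pi} ?h"
      using \<open>set_integrable lborel {c - R..c + R} ?h\<close> by simp
    show "((\<lambda>x. c - R * cos x) has_real_derivative R * sin x) (at x)" for x
      by (auto intro!: derivative_eq_intros)
    show "0 \<le> R * sin x" if "x \<in> {0..pi}" for x
      using that assms(1) by (simp add: sin_ge_zero)
  qed (auto intro!: continuous_intros)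
  then show "(LBINT x. ?h x * indicator {c - R..c + R} x)
      = (LBINT x. f (c - R * cos x) * (R * sin x)\<^sup>2 * indicator {0..pi} x)"
    unfolding pointwise by simp
qed

section \<open>The size-biased Marchenko-Pastur law\<close>

lemma borel_measurable_mp_density [measurable]: "mp_density r v \<in> borel_measurable borel"
  unfolding mp_density_def Let_def by measurable

text \<open>The two measures agree on all Borel sets that avoid the atom, and an integrand vanishing
  at 0 sees only the complement of 0. Hence the comparison goes through restrictions to
  \<open>- {0}\<close>.\<close>

lemma nn_integral_marchenko_pastur_zero_at_0:
  assumes [measurable]: "f \<in> borel_measurable borel" and "f 0 = 0"
  shows "(\<integral>\<^sup>+x. f x \<partial>marchenko_pastur r v) = (\<integral>\<^sup>+x. ennreal (mp_density r v x) * f x \<partial>lborel)"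
proof -
  let ?N = "density lborel (\<lambda>x. ennreal (mp_density r v x))"
  have restrict: "restrict_space (marchenko_pastur r v) (- {0}) = restrict_space ?N (- {0})"
  proof (rule measure_eqI)
    show "sets (restrict_space (marchenko_pastur r v) (- {0})) = sets (restrict_space ?N (- {0}))"
      by (simp add: sets_restrict_space)
    fix A assume "A \<in> sets (restrict_space (marchenko_pastur r v) (- {0}))"
    then have A: "A \<in> sets borel" "A \<subseteq> - {0}"
      by (auto simp: sets_restrict_space)
    then have "0 \<notin> A" by auto
    with A show "emeasure (restrict_space (marchenko_pastur r v) (- {0})) A
        = emeasure (restrict_space ?N (- {0})) A"
      by (simp add: emeasure_restrict_space emeasure_marchenko_pastur)
  qed
  have f: "f = (\<lambda>x. f x * indicator (- {0}) x)"
    using assms(2) by (auto simp: fun_eq_iff indicator_def)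
  have "(\<integral>\<^sup>+x. f x \<partial>marchenko_pastur r v) = (\<integral>\<^sup>+x. f x \<partial>restrict_space (marchenko_pastur r v) (- {0}))"
    by (subst nn_integral_restrict_space) (simp_all flip: f)
  also have "\<dots> = (\<integral>\<^sup>+x. f x \<partial>?N)"
    unfolding restrict by (subst nn_integral_restrict_space) (simp_all flip: f)
  finally show ?thesis
    by (simp add: nn_integral_density)
qed

text \<open>The ends of the support are \<open>c - R\<close> and \<open>c + R\<close>, so completing
  the square turns the numerator of the density into that of a semicircle. The resulting measure has
  total mass \<open>v\<close>.\<close>

lemma size_biased_marchenko_pastur:
  assumes "r > 0" "v > 0"
  defines "c \<equiv> v * (1 + r)" and "R \<equiv> 2 * v * sqrt r"
  shows "density (marchenko_pastur r v) (\<lambda>x. ennreal x)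
    = density lborel (\<lambda>x. ennreal (sqrt (R\<^sup>2 - (x - c)\<^sup>2) / (2 * pi * v * r) * indicator {c - R..c + R} x))"
proof (rule measure_eqI)
  fix A assume "A \<in> sets (density (marchenko_pastur r v) (\<lambda>x. ennreal x))"
  then have [measurable]: "A \<in> sets borel" by simp
  have ends: "v * (1 - sqrt r)\<^sup>2 = c - R" "v * (1 + sqrt r)\<^sup>2 = c + R"
    using assms(1) by (simp_all add: c_def R_def power2_eq_square algebra_simps)
  have "c - R \<ge> 0"
    unfolding ends(1)[symmetric] using assms(2) by simp
  have weight: "mp_density r v x * x
      = sqrt (R\<^sup>2 - (x - c)\<^sup>2) / (2 * pi * v * r) * indicator {c - R..c + R} x" for x
  proof (cases "x \<in> {c - R..c + R}")
    case True
    have product: "(c + R - x) * (x - (c - R)) = R\<^sup>2 - (x - c)\<^sup>2"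
      by (simp add: power2_eq_square algebra_simps)
    show ?thesis
    \<comment> \<open>At \<open>x = 0\<close> the factor \<open>x\<close> cannot be cancelled. This
      point lies in the support only if \<open>c = R\<close>, and then both sides are 0.\<close>
    proof (cases "x = 0")
      case True
      with \<open>x \<in> _\<close> \<open>c - R \<ge> 0\<close> have "c = R" by auto
      with True show ?thesis by simp
    next
      case False
      then show ?thesis
        using True by (simp add: mp_density_def Let_def ends product)
    qed
  qed (simp add: mp_density_def Let_def ends)
  have nonneg: "x \<ge> 0" if "x \<in> {c - R..c + R}" for x
    using that \<open>c - R \<ge> 0\<close> by simp
  \<comment> \<open>\<open>ennreal\<close> truncates negative \<open>x\<close> to 0, which is
    harmless because the density vanishes outside an interval of nonnegative numbers.\<close>
  have pointwise: "ennreal (mp_density r v x) * (ennreal x * indicator A x)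
      = ennreal (mp_density r v x * x) * indicator A x" for x
  proof (cases "x \<in> {c - R..c + R}")
    case True
    then show ?thesis by (simp only: ennreal_mult''[OF nonneg] mult.assoc)
  next
    case False
    then have "mp_density r v x = 0" by (simp add: mp_density_def Let_def ends)
    then show ?thesis by simp
  qed
  have [measurable]: "(\<lambda>x. ennreal x) \<in> borel_measurable (marchenko_pastur r v)"
    by measurable
  have "emeasure (density (marchenko_pastur r v) (\<lambda>x. ennreal x)) A
      = (\<integral>\<^sup>+x. ennreal x * indicator A x \<partial>marchenko_pastur r v)"
    by (simp add: emeasure_density)
  also have "\<dots> = (\<integral>\<^sup>+x. ennreal (mp_density r v x * x) * indicator A x \<partial>lborel)"
    by (subst nn_integral_marchenko_pastur_zero_at_0) (simp_all add: pointwise)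
  finally show "emeasure (density (marchenko_pastur r v) (\<lambda>x. ennreal x)) A
      = emeasure (density lborel (\<lambda>x. ennreal (sqrt (R\<^sup>2 - (x - c)\<^sup>2) / (2 * pi * v * r)
          * indicator {c - R..c + R} x))) A"
    by (simp add: emeasure_density weight)
qed simp

text \<open>The substitution turns the weight into \<open>(sin x)\<^sup>2\<close>; the constant is
  \<open>R\<^sup>2 / (2 * pi * v * r) = 2 * v / pi\<close>.\<close>

lemma integral_size_biased_marchenko_pastur:
  fixes f :: "real \<Rightarrow> real"
  assumes "r > 0" "v > 0" and f: "continuous_on UNIV f"
  defines "c \<equiv> v * (1 + r)" and "R \<equiv> 2 * v * sqrt r"
  shows "integrable (density (marchenko_pastur r v) (\<lambda>x. ennreal x)) f"
    and "(LINT x|density (marchenko_pastur r v) (\<lambda>x. ennreal x). f x)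
      = 2 * v / pi * (LBINT x. f (c - R * cos x) * (sin x)\<^sup>2 * indicator {0..pi} x)"
proof -
  let ?w = "\<lambda>x. sqrt (R\<^sup>2 - (x - c)\<^sup>2) / (2 * pi * v * r) * indicator {c - R..c + R} x"
  have [measurable]: "f \<in> borel_measurable borel"
    using f by (rule borel_measurable_continuous_onI)
  have "R > 0"
    using assms(1,2) by (simp add: R_def)
  note subst = LINT_semicircle_substitution[OF \<open>R > 0\<close> f, of c]
  have "?w x \<ge> 0" for x
  proof (cases "x \<in> {c - R..c + R}")
    case True
    then have "\<bar>x - c\<bar> \<le> \<bar>R\<bar>" by auto
    then have "(x - c)\<^sup>2 \<le> R\<^sup>2" by (simp only: abs_le_square_iff)
    then show ?thesis using assms(1,2) by simp
  qed simp
  then have nonneg: "AE x in lborel. 0 \<le> ?w x" by simp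
  have weighted: "?w x *\<^sub>R f x = f x * sqrt (R\<^sup>2 - (x - c)\<^sup>2) * indicator {c - R..c + R} x
      / (2 * pi * v * r)" for x
    by simp
  note density = size_biased_marchenko_pastur[OF assms(1,2), folded c_def R_def]
  show "integrable (density (marchenko_pastur r v) (\<lambda>x. ennreal x)) f"
    unfolding density
    by (subst integrable_density[OF _ _ nonneg]) (simp_all only: weighted subst integrable_divide_zero, measurable)
  have "(LINT x|density (marchenko_pastur r v) (\<lambda>x. ennreal x). f x)
      = (LBINT x. f (c - R * cos x) * (R * sin x)\<^sup>2 * indicator {0..pi} x) / (2 * pi * v * r)"
    unfolding density
    by (subst integral_density[OF _ _ nonneg]) (simp_all only: weighted subst integral_divide_zero, measurable)
  also have "(\<lambda>x. f (c - R * cos x) * (R * sin x)\<^sup>2 * indicator {0..pi} x)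
      = (\<lambda>x. R\<^sup>2 * (f (c - R * cos x) * (sin x)\<^sup>2 * indicator {0..pi} x))"
    by (simp add: power_mult_distrib mult_ac)
  also have "(LBINT x. R\<^sup>2 * (f (c - R * cos x) * (sin x)\<^sup>2 * indicator {0..pi} x)) / (2 * pi * v * r)
      = 2 * v / pi * (LBINT x. f (c - R * cos x) * (sin x)\<^sup>2 * indicator {0..pi} x)"
    unfolding integral_mult_right_zero using assms(1,2)
    by (simp add: R_def power2_eq_square field_simps)
  finally show "(LINT x|density (marchenko_pastur r v) (\<lambda>x. ennreal x). f x)
      = 2 * v / pi * (LBINT x. f (c - R * cos x) * (sin x)\<^sup>2 * indicator {0..pi} x)" .
qed

section \<open>The recurrence and its Chebyshev form\<close>

lemma delta_bounds:
  fixes \<delta> :: "int \<Rightarrow> real"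
  assumes "\<rho> \<ge> 2" and "\<delta> 0 = 0"
    and "\<And>t. t \<ge> 1 \<Longrightarrow> \<delta> t = inverse (- \<rho> - \<delta> (t - 1))"
  shows "- 1 < \<delta> (int n) \<and> \<delta> (int n) \<le> 0"
proof (induction n)
  case (Suc n)
  \<comment> \<open>The bounds reproduce themselves: they give a denominator above 1, whose negated
    inverse lies strictly between -1 and 0. In particular no denominator vanishes.\<close>
  have "\<delta> (int (Suc n)) = - inverse (\<rho> + \<delta> (int n))"
    using assms(3)[of "int (Suc n)"] by (simp flip: inverse_minus_eq)
  moreover have "\<rho> + \<delta> (int n) > 1"
    using Suc assms(1) by simp
  ultimately show ?case
    by (simp add: inverse_less_1_iff)
qed (simp add: assms)

theorem theorem17:
  fixes r \<sigma> \<rho> :: real and \<delta> :: "int \<Rightarrow> real" and P :: "int \<Rightarrow> real poly"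
  assumes "r > 0" and "\<sigma> > 0"
    and "\<rho> = (1 + r) / sqrt r"
    and "\<delta> 0 = 0"
    and "\<And>t. t \<ge> 1 \<Longrightarrow> \<delta> t = inverse (- \<rho> - \<delta> (t - 1))"
    and "P (- 1) = 0" and "P 0 = 1"
    and "\<And>t. t \<ge> 1 \<Longrightarrow>
           P t = [: - \<rho> * \<delta> t, \<delta> t / (\<sigma>^2 * sqrt r) :] * P (t - 1)
                 + smult (1 + \<rho> * \<delta> t) (P (t - 2))"
  shows "orthogonal_polynomials
           (density (marchenko_pastur r (\<sigma>^2)) (\<lambda>x. ennreal x))
           (\<lambda>n. P (int n))"
proof -
  let ?\<alpha> = "density (marchenko_pastur r (\<sigma>\<^sup>2)) (\<lambda>x. ennreal x)"
  define v where "v = \<sigma>\<^sup>2"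
  define c where "c = v * (1 + r)"
  define R where "R = 2 * v * sqrt r"
  define a where "a n = (\<Prod>i<n. - \<delta> (int (Suc i)))" for n
  have "v > 0" using assms(2) by (simp add: v_def)
  have "0 \<le> (1 - sqrt r)\<^sup>2" by simp
  also have "\<dots> = 1 + r - 2 * sqrt r"
    using assms(1) by (simp add: power2_eq_square algebra_simps)
  finally have "\<rho> \<ge> 2"
    unfolding assms(3) using assms(1) by (simp add: field_simps)
  note \<delta> = delta_bounds[of \<rho> \<delta>, OF \<open>\<rho> \<ge> 2\<close> assms(4,5)]
  \<comment> \<open>The recursion cleared of its denominator yields both \<delta> \<noteq> 0 and the
    form of the coefficient of the older polynomial.\<close>
  have \<delta>_Suc: "\<delta> (int (Suc n)) * (\<rho> + \<delta> (int n)) = - 1" for n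
  proof -
    have "\<rho> + \<delta> (int n) \<noteq> 0" using \<delta>[of n] \<open>\<rho> \<ge> 2\<close> by linarith
    then show ?thesis
      using assms(5)[of "int (Suc n)"] by (simp add: field_simps)
  qed
  have \<delta>_neg: "\<delta> (int (Suc n)) < 0" for n
    using \<delta>_Suc[of n] \<delta>[of "Suc n"] by (cases "\<delta> (int (Suc n)) = 0") auto
  have a_pos: "a n > 0" for n
    unfolding a_def using \<delta>_neg by (intro prod_pos) auto
  have P_Suc: "P (int (Suc n)) = [: - \<rho> * \<delta> (int (Suc n)), \<delta> (int (Suc n)) / (v * sqrt r) :] * P (int n)
      + smult (1 + \<rho> * \<delta> (int (Suc n))) (P (int n - 1))" for n
    using assms(8)[of "int (Suc n)"] by (simp add: v_def)

  \<comment> \<open>The induction also carries \<open>P (int n) \<noteq> 0\<close>, since degree 0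
    does not exclude the zero polynomial, and a bound at \<open>n - 1\<close> that covers
    \<open>P (- 1) = 0\<close>.\<close>
  have deg: "degree (P (int n)) = n \<and> degree (P (int n - 1)) \<le> n \<and> P (int n) \<noteq> 0" for n
  proof (induction n)
    case (Suc n)
    define p where "p = [: - \<rho> * \<delta> (int (Suc n)), \<delta> (int (Suc n)) / (v * sqrt r) :]"
    have "\<delta> (int (Suc n)) / (v * sqrt r) \<noteq> 0"
      using \<delta>_neg[of n] \<open>v > 0\<close> assms(1) by simp
    then have "degree p = 1" "p \<noteq> 0"
      unfolding p_def by (simp_all del: of_nat_Suc)
    then have "degree (p * P (int n)) = Suc n"
      using Suc by (simp add: degree_mult_eq)
    moreover have "degree (smult (1 + \<rho> * \<delta> (int (Suc n))) (P (int n - 1))) < Suc n"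
      using Suc by (intro le_less_trans[OF degree_smult_le]) simp
    ultimately have "degree (P (int (Suc n))) = Suc n"
      unfolding P_Suc by (simp only: degree_add_eq_left flip: p_def)
    then show ?case
      using Suc by auto
  qed (simp add: assms)

  \<comment> \<open>This says that \<open>P (int n)\<close> is \<open>a n\<close> times the
    Chebyshev polynomial of the second kind in \<open>cos x\<close>; the factor \<open>sin x\<close>
    avoids a division at its zeros.\<close>
  have sin_form: "poly (P (int n)) (c - R * cos x) * sin x = a n * sin (real (Suc n) * x)" for n x
  proof (induction n rule: less_induct)
    case (less n)
    have step: "poly [: - \<rho> * \<delta> (int (Suc m)), \<delta> (int (Suc m)) / (v * sqrt r) :] (c - R * cos x)
        = - \<delta> (int (Suc m)) * (2 * cos x)" for m
    proof -
      have "(c - R * cos x) / (v * sqrt r) - \<rho> = - 2 * cos x"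
        using \<open>v > 0\<close> assms(1) by (simp add: c_def R_def assms(3) field_simps)
      then have "\<delta> (int (Suc m)) * ((c - R * cos x) / (v * sqrt r) - \<rho>)
          = \<delta> (int (Suc m)) * (- 2 * cos x)" by simp
      then show ?thesis by (simp add: algebra_simps)
    qed
    consider "n = 0" | "n = 1" | m where "n = Suc (Suc m)"
      by (metis One_nat_def not0_implies_Suc)
    then show ?case
    proof cases
      case 1
      then show ?thesis by (simp add: assms a_def)
    next
      case 2
      \<comment> \<open>Here the recurrence reaches back to index -1, with coefficient 0 because
        \<delta> starts at 0.\<close>
      have "1 + \<rho> * \<delta> (int (Suc 0)) = 0"
        using \<delta>_Suc[of 0] assms(4) by (simp add: mult.commute)
      then have "poly (P (int (Suc 0))) (c - R * cos x) = - \<delta> (int (Suc 0)) * (2 * cos x)"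
        unfolding P_Suc poly_add poly_mult step by (simp add: assms)
      then show ?thesis
        using 2 by (simp add: a_def sin_double)
    next
      case 3
      let ?d = "\<delta> (int (Suc (Suc m)))" and ?d' = "\<delta> (int (Suc m))"
      let ?s = "\<lambda>k. sin (real k * x)"
      have coeff: "1 + \<rho> * ?d = - (?d * ?d')"
        using \<delta>_Suc[of "Suc m"] by (simp add: algebra_simps)
      \<comment> \<open>Both coefficients of the recurrence are matched to ratios of
        \<open>a\<close>, so that \<open>a n\<close> factors out and the plain Chebyshev recurrence
        remains.\<close>
      have a: "a (Suc m) = - ?d' * a m" "a n = ?d * ?d' * a m"
        by (simp_all add: a_def 3)
      have chebyshev: "2 * cos x * ?s (Suc (Suc m)) - ?s (Suc m) = ?s (Suc n)"
      proof -
        have "?s (Suc n) = sin (real (Suc (Suc m)) * x + x)" 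
             "?s (Suc m) = sin (real (Suc (Suc m)) * x - x)"
          by (simp_all add: 3 algebra_simps)
        then show ?thesis by (simp add: sin_add sin_diff del: of_nat_Suc)
      qed
      have "poly (P (int n)) (c - R * cos x) * sin x
          = - ?d * (2 * cos x) * (poly (P (int (Suc m))) (c - R * cos x) * sin x)
            - ?d * ?d' * (poly (P (int m)) (c - R * cos x) * sin x)"
        unfolding 3 P_Suc[of "Suc m"] poly_add poly_mult step coeff by (simp add: algebra_simps)
      also have "\<dots> = - ?d * (2 * cos x) * (a (Suc m) * ?s (Suc (Suc m))) - ?d * ?d' * (a m * ?s (Suc m))"
        using less[of m] less[of "Suc m"] 3 by simp
      also have "\<dots> = ?d * ?d' * a m * (2 * cos x * ?s (Suc (Suc m)) - ?s (Suc m))"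
        unfolding a by (simp add: algebra_simps del: of_nat_Suc)
      finally show ?thesis
        unfolding chebyshev a .
    qed
  qed

  \<comment> \<open>Each polynomial takes one of the two sines of the weight, as
    \<open>sin_form\<close> requires. The diagonal value supplies positivity.\<close>
  have inner: "(LINT x|?\<alpha>. poly (P (int i)) x * poly (P (int j)) x)
      = (if i = j then v * a i * a j else 0)" for i j
  proof -
    let ?p = "\<lambda>k x. poly (P (int k)) (c - R * cos x)"
    have "?p i x * ?p j x * (sin x)\<^sup>2 * indicator {0..pi} x
        = (?p i x * sin x) * (?p j x * sin x) * indicator {0..pi} x" for x :: real
      by (simp add: power2_eq_square mult_ac)
    then have product: "?p i x * ?p j x * (sin x)\<^sup>2 * indicator {0..pi} x
        = a i * a j * (sin (real (Suc i) * x) * sin (real (Suc j) * x) * indicator {0..pi} x)"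
      for x :: real
      unfolding sin_form by (simp only: mult_ac)
    have "(LINT x|?\<alpha>. poly (P (int i)) x * poly (P (int j)) x)
        = 2 * v / pi * (LBINT x. ?p i x * ?p j x * (sin x)\<^sup>2 * indicator {0..pi} x)"
      unfolding v_def[symmetric] c_def R_def using assms(1) \<open>v > 0\<close>
      by (intro integral_size_biased_marchenko_pastur) (auto intro!: continuous_intros)
    also have "\<dots> = 2 * v / pi * (a i * a j * (if Suc i = Suc j then pi / 2 else 0))"
      unfolding product integral_mult_right_zero by (subst LINT_sin_times_sin) simp_all
    finally show ?thesis
      by simp
  qed

  show ?thesis
    unfolding orthogonal_polynomials_def
  proof (intro conjI allI impI)
    show "integrable ?\<alpha> (\<lambda>x. poly p x)" for p
      using assms(1,2) by (intro integral_size_biased_marchenko_pastur) (auto intro!: continuous_intros)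
    show "degree (P (int i)) = i" for i
      using deg by simp
    show "(LINT x|?\<alpha>. poly (P (int i)) x * poly (P (int j)) x) = 0" if "i \<noteq> j" for i j
      using that by (simp add: inner)
    show "(LINT x|?\<alpha>. (poly (P (int i)) x)\<^sup>2) > 0" for i
      using inner[of i i] a_pos[of i] \<open>v > 0\<close> by (simp add: power2_eq_square)
  qed
qed

end
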